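(* For all integers $1\le k\le n$, we have $p(k,n)\ge p(k,n+1)$ (i.e. $p(k,n)$ is decreasing, in the weak sense, in $n$) and $p(k,n)\ge p(k+1,n+1)$. Furthermore, for every integer $k\ge1$ the limit $p(k,\infty):=\lim_{n\to\infty}p(k,n)$ is well defined (exists), and $p(k,\infty)\ge p(k+1,\infty)$.
   Context: Setting: for each $n\ge 1$, $(R_1,\dots,R_n)$ is a uniformly random permutation of $(1,2,\dots,n)$ ($R_j$ is the absolute rank of the $j$-th candidate, rank 1 being the best), and $X_j=|\{1\le i\le j: R_i\le R_j\}|$ is the relative rank of the $j$-th candidate among the first $j$. $\mathcal{F}_j$ is the $\sigma$-algebra generated by $X_1,\dots,X_j$, and $\mathcal{M}_n$ is the set of all stopping rules with values in $\{1,\dots,n\}$ adapted to $\{\mathcal{F}_j\}$. For $1\le k\le n$, $$p(k,n):=\sup_{\tau\in\mathcal{M}_n}P(R_\tau=k),$$ the maximum probability of selecting the $k$-th best of $n$ candidates. *)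

theory Defs
  imports "HOL-Probability.Probability" "HOL-Combinatorics.Permutations"
begin

text \<open>
  A sample point is a permutation \<open>R\<close> of \<open>{1..n}\<close> (the identity outside \<open>{1..n}\<close>, as
  \<^const>\<open>permutes\<close> requires); \<open>R j\<close> is the absolute rank of the \<open>j\<close>-th candidate.
\<close>

definition rank_space :: "nat \<Rightarrow> (nat \<Rightarrow> nat) measure" where
  "rank_space n = uniform_count_measure {R. R permutes {1..n}}"

definition rel_rank :: "nat \<Rightarrow> (nat \<Rightarrow> nat) \<Rightarrow> nat" where
  "rel_rank j R = card {i. 1 \<le> i \<and> i \<le> j \<and> R i \<le> R j}"

text \<open>
  The \<open>\<sigma>\<close>-algebra generated by \<open>rel_rank 1, \<dots>, rel_rank j\<close>. It is indexed by all
  natural numbers, because \<^const>\<open>stopping_time\<close> quantifies over the whole index type: it is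
  trivial for \<open>j = 0\<close>, and constant for \<open>j \<ge> n\<close> since \<open>rel_rank i\<close> is constant on the sample
  space for \<open>i > n\<close>.
\<close>

definition rank_filtration :: "nat \<Rightarrow> nat \<Rightarrow> (nat \<Rightarrow> nat) measure" where
  "rank_filtration n j =
     sigma (space (rank_space n))
       {rel_rank i -` A \<inter> space (rank_space n) | i A. 1 \<le> i \<and> i \<le> j}"

definition stopping_rules :: "nat \<Rightarrow> ((nat \<Rightarrow> nat) \<Rightarrow> nat) set" where
  "stopping_rules n =
     {\<tau>. stopping_time (rank_filtration n) \<tau> \<and> \<tau> \<in> space (rank_space n) \<rightarrow> {1..n}}"

text \<open>
  The supremum is over a nonempty set of reals bounded by \<open>1\<close> whenever \<open>n \<ge> 1\<close>; the value at
  \<open>n = 0\<close> is meaningless.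
\<close>

definition p_best :: "nat \<Rightarrow> nat \<Rightarrow> real" where
  "p_best k n = (SUP \<tau>\<in>stopping_rules n. \<P>(R in rank_space n. R (\<tau> R) = k))"

definition p_inf :: "nat \<Rightarrow> real" where
  "p_inf k = lim (\<lambda>n. p_best k n)"

end

theory Submission
  imports Defs
begin

text \<open>
  Insert into a uniformly random ranking of \<open>n\<close> candidates a fictitious candidate that is worse
  than all others (or better than all others), at a uniformly random position \<open>m\<close>. This gives a
  uniformly random ranking of \<open>n + 1\<close> candidates, whose relative ranks can be computed online from
  those of the original ranking because the fictitious candidate is extreme. A stopping rule for
  \<open>n + 1\<close> can therefore be simulated for \<open>n\<close> candidates. The fictitious candidate is never the
  desired one, and inserting it leaves the rank \<open>k\<close> unchanged (or turns it into \<open>k + 1\<close>), so the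
  average over \<open>m\<close> of the success probabilities of the simulated rules is at least that of the
  given rule.
\<close>

section \<open>Stopping rules in terms of relative ranks\<close>

text \<open>On permutations of \<open>{1..n}\<close>, the classes of \<open>agree j\<close> are the
  atoms of \<open>rank_filtration n j\<close>.\<close>

definition agree :: "nat \<Rightarrow> (nat \<Rightarrow> nat) \<Rightarrow> (nat \<Rightarrow> nat) \<Rightarrow> bool" where
  "agree j R S \<longleftrightarrow> (\<forall>i. 1 \<le> i \<and> i \<le> j \<longrightarrow> rel_rank i R = rel_rank i S)"

lemma agree_sym: "agree j R S \<Longrightarrow> agree j S R"
  by (simp add: agree_def)

lemma agree_mono: "agree j R S \<Longrightarrow> i \<le> j \<Longrightarrow> agree i R S"
  by (auto simp: agree_def)

lemma space_rank_space: "space (rank_space n) = {R. R permutes {1..n}}"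
  by (simp add: rank_space_def space_uniform_count_measure)

lemma space_rank_filtration: "space (rank_filtration n j) = {R. R permutes {1..n}}"
  unfolding rank_filtration_def
  by (subst space_measure_of) (auto simp: space_rank_space)

lemma sets_rank_filtration:
  "sets (rank_filtration n j) = sigma_sets {R. R permutes {1..n}}
     {rel_rank i -` A \<inter> {R. R permutes {1..n}} | i A. 1 \<le> i \<and> i \<le> j}"
  unfolding rank_filtration_def
  by (subst sets_measure_of) (auto simp: space_rank_space)

text \<open>Unions of atoms form a \<sigma>-algebra containing the generators. Conversely, each atom
  is a finite intersection of generators, and the sample space is finite.\<close>

lemma sets_rank_filtration_iff:
  "S \<in> sets (rank_filtration n j) \<longleftrightarrow>
     S \<subseteq> {R. R permutes {1..n}} \<and>
     (\<forall>R Q. R permutes {1..n} \<and> Q permutes {1..n} \<and> agree j R Q \<longrightarrow> (R \<in> S \<longleftrightarrow> Q \<in> S))"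
    (is "_ \<longleftrightarrow> ?rhs S")
proof
  let ?\<Omega> = "{R. R permutes {1..n}}"
  assume "S \<in> sets (rank_filtration n j)"
  then have "S \<in> sigma_sets ?\<Omega> {rel_rank i -` A \<inter> ?\<Omega> | i A. 1 \<le> i \<and> i \<le> j}"
    by (simp add: sets_rank_filtration)
  then show "?rhs S"
  proof (induction rule: sigma_sets.induct)
    case (Union a)
    then show ?case by (simp add: UN_subset_iff) blast
  qed (auto simp: agree_def)
next
  let ?\<Omega> = "{R. R permutes {1..n}}"
  let ?C = "\<lambda>R. {Q \<in> ?\<Omega>. agree j R Q}"
  assume S: "?rhs S"
  have cell: "?C R \<in> sets (rank_filtration n j)" for R
  proof -
    \<comment> \<open>The case \<open>j = 0\<close> is separate: an intersection over no indices is
      \<open>UNIV\<close>, which is not an event.\<close>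
    have "?C R = ?\<Omega> \<inter> (\<Inter>i\<in>{1..j}. rel_rank i -` {rel_rank i R} \<inter> ?\<Omega>)"
      if "j \<noteq> 0" using that by (auto simp: agree_def)
    moreover have "?C R = ?\<Omega>" if "j = 0"
      using that by (auto simp: agree_def)
    moreover have "?\<Omega> \<in> sets (rank_filtration n j)"
      using sets.top[of "rank_filtration n j"] by (simp add: space_rank_filtration)
    moreover have "(\<Inter>i\<in>{1..j}. rel_rank i -` {rel_rank i R} \<inter> ?\<Omega>) \<in> sets (rank_filtration n j)"
      if "j \<noteq> 0"
      using that by (intro sets.finite_INT) (auto simp: sets_rank_filtration)
    ultimately show ?thesis
      by (cases "j = 0") (metis (no_types, lifting), metis (no_types, lifting) sets.Int)
  qed
  have "S = (\<Union>R\<in>S. ?C R)"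
    using S by (auto simp: agree_def)
  moreover have "finite S"
    by (rule finite_subset[OF conjunct1[OF S]]) (simp add: finite_permutations)
  ultimately show "S \<in> sets (rank_filtration n j)"
    using cell sets.finite_UN[of S ?C] by simp
qed

text \<open>Measurability at time \<open>\<tau> R\<close> gives
  \<open>\<tau> Q \<le> \<tau> R\<close>; hence \<open>R\<close> and \<open>Q\<close> also agree up
  to \<open>\<tau> Q\<close>, and the same argument applies with the roles exchanged.\<close>

lemma stopping_rules_iff:
  "\<tau> \<in> stopping_rules n \<longleftrightarrow>
     (\<forall>R. R permutes {1..n} \<longrightarrow> \<tau> R \<in> {1..n}) \<and>
     (\<forall>R Q. R permutes {1..n} \<and> Q permutes {1..n} \<and> agree (\<tau> R) R Q \<longrightarrow> \<tau> Q = \<tau> R)"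
    (is "_ \<longleftrightarrow> ?range \<and> ?adapted")
proof -
  have "stopping_time (rank_filtration n) \<tau> \<longleftrightarrow>
      (\<forall>j R Q. R permutes {1..n} \<and> Q permutes {1..n} \<and> agree j R Q \<longrightarrow> (\<tau> R \<le> j \<longleftrightarrow> \<tau> Q \<le> j))"
    unfolding stopping_time_def pred_def sets_rank_filtration_iff space_rank_filtration
    by auto
  also have "\<dots> \<longleftrightarrow> ?adapted"
  proof safe
    fix R Q
    assume st: "\<forall>j R Q. R permutes {1..n} \<and> Q permutes {1..n} \<and> agree j R Q
        \<longrightarrow> (\<tau> R \<le> j \<longleftrightarrow> \<tau> Q \<le> j)"
      and RQ: "R permutes {1..n}" "Q permutes {1..n}" "agree (\<tau> R) R Q"
    have le: "\<tau> Q \<le> \<tau> R" using st RQ by blast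
    then have "agree (\<tau> Q) R Q" using RQ(3) agree_mono by blast
    then have "\<tau> R \<le> \<tau> Q" using st RQ by blast
    with le show "\<tau> Q = \<tau> R" by simp
  next
    fix j R Q
    assume "?adapted" "R permutes {1..n}" "Q permutes {1..n}" "agree j R Q" "\<tau> R \<le> j"
    then show "\<tau> Q \<le> j" by (metis agree_mono)
  next
    fix j R Q
    assume "?adapted" "R permutes {1..n}" "Q permutes {1..n}" "agree j R Q" "\<tau> Q \<le> j"
    then show "\<tau> R \<le> j" by (metis agree_mono agree_sym)
  qed
  finally show ?thesis
    by (auto simp: stopping_rules_def space_rank_space Pi_iff)
qed

lemma const_stopping_rule: "1 \<le> n \<Longrightarrow> (\<lambda>_. n) \<in> stopping_rules n"
  by (simp add: stopping_rules_iff)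

section \<open>Success probabilities\<close>

lemma prob_rank_space:
  "\<P>(R in rank_space n. P R) = card {R. R permutes {1..n} \<and> P R} / fact n"
proof -
  have "\<P>(R in rank_space n. P R) =
      measure (uniform_count_measure {R. R permutes {1..n}}) {R. R permutes {1..n} \<and> P R}"
    by (simp add: rank_space_def space_uniform_count_measure)
  also have "\<dots> = card {R. R permutes {1..n} \<and> P R} / card {R. R permutes {1..n}}"
    by (rule measure_uniform_count_measure) (auto simp: finite_permutations)
  finally show ?thesis
    by (simp add: card_permutations)
qed

lemma prob_rank_space_le_1: "\<P>(R in rank_space n. P R) \<le> 1"
proof -
  have "card {R. R permutes {1..n} \<and> P R} \<le> card {R. R permutes {1..n}}"
    by (rule card_mono) (auto simp: finite_permutations)
  also have "\<dots> = fact n" by (simp add: card_permutations)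
  finally have "real (card {R. R permutes {1..n} \<and> P R}) \<le> fact n"
    by (metis of_nat_fact of_nat_le_iff)
  then show ?thesis
    unfolding prob_rank_space by (simp add: divide_le_eq)
qed

lemma prob_le_p_best:
  "\<tau> \<in> stopping_rules n \<Longrightarrow> \<P>(R in rank_space n. R (\<tau> R) = k) \<le> p_best k n"
  unfolding p_best_def
  by (rule cSUP_upper) (auto intro!: bdd_aboveI2 prob_rank_space_le_1)

lemma p_best_nonneg: "1 \<le> n \<Longrightarrow> 0 \<le> p_best k n"
  using prob_le_p_best[OF const_stopping_rule] measure_nonneg order_trans by blast

section \<open>Inserting a candidate\<close>

text \<open>The increasing enumeration of all naturals except \<open>m\<close>. It shifts both
  positions (around \<open>m\<close>) and ranks (around \<open>c\<close>).\<close>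

definition skip :: "nat \<Rightarrow> nat \<Rightarrow> nat" where
  "skip m i = (if i < m then i else Suc i)"

text \<open>A left inverse of \<open>skip m\<close>; the value \<open>m\<close> at the missed index
  \<open>m\<close> is a default.\<close>

definition unskip :: "nat \<Rightarrow> nat \<Rightarrow> nat" where
  "unskip m i = (if i \<le> m then i else i - 1)"

definition ins :: "nat \<Rightarrow> nat \<Rightarrow> (nat \<Rightarrow> nat) \<Rightarrow> nat \<Rightarrow> nat" where
  "ins c m R j = (if j = m then c else skip c (R (if j < m then j else j - 1)))"

lemma skip_le_iff [simp]: "skip m i \<le> skip m j \<longleftrightarrow> i \<le> j"
  by (auto simp: skip_def)

lemma skip_eq_iff [simp]: "skip m i = skip m j \<longleftrightarrow> i = j"
  by (auto simp: skip_def)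

lemma skip_neq [simp]: "skip m i \<noteq> m" "m \<noteq> skip m i"
  by (auto simp: skip_def)

lemma unskip_skip [simp]: "unskip m (skip m i) = i"
  by (auto simp: skip_def unskip_def)

lemma skip_cases:
  obtains "j = m" | i where "j = skip m i"
proof (cases j m rule: linorder_cases)
  case less
  then show ?thesis using that(2)[of j] by (simp add: skip_def)
next
  case greater
  then show ?thesis using that(2)[of "j - 1"] by (simp add: skip_def)
qed (use that(1) in simp)

lemma ins_same [simp]: "ins c m R m = c"
  by (simp add: ins_def)

lemma ins_skip [simp]: "ins c m R (skip m i) = skip c (R i)"
  by (auto simp: ins_def skip_def)

lemma ins_permutes:
  assumes R: "R permutes {1..n}" and c: "c \<in> {1..Suc n}" and m: "m \<in> {1..Suc n}"
  shows "ins c m R permutes {1..Suc n}"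
proof (rule inj_imp_permutes)
  show "inj_on (ins c m R) {1..Suc n}"
  proof (rule inj_onI)
    fix x y assume "ins c m R x = ins c m R y"
    then show "x = y"
      using permutes_inj[OF R]
      by (cases x m rule: skip_cases; cases y m rule: skip_cases) (auto dest: injD)
  qed
  fix x
  show "ins c m R x \<in> {1..Suc n}" if "x \<in> {1..Suc n}"
  proof (cases x m rule: skip_cases)
    case (2 i)
    then have "i \<in> {1..n}" using that m by (auto simp: skip_def split: if_splits)
    then have "R i \<in> {1..n}" using permutes_in_image[OF R] by blast
    then show ?thesis unfolding 2 ins_skip by (auto simp: skip_def)
  qed (use c in simp)
  \<comment> \<open>Outside \<open>{1..Suc n}\<close> the shifts of positions and ranks coincide: 0
    stays fixed and every \<open>i > n\<close> becomes \<open>Suc i\<close>, as \<open>m\<close> and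
    \<open>c\<close> lie in \<open>{1..Suc n}\<close>.\<close>
  show "ins c m R x = x" if "x \<notin> {1..Suc n}"
  proof (cases x m rule: skip_cases)
    case (2 i)
    then have "i \<notin> {1..n}" using that m by (auto simp: skip_def split: if_splits)
    then have "R i = i" using permutes_not_in[OF R] by blast
    then show ?thesis
      unfolding 2 ins_skip using that 2 c m by (auto simp: skip_def split: if_splits)
  qed (use m that in simp)
qed simp

text \<open>The position \<open>m\<close> is recovered as the place of rank \<open>c\<close>, which
  gives injectivity; surjectivity follows by counting,
  \<open>(n + 1) * n! = (n + 1)!\<close>.\<close>

lemma bij_betw_ins:
  assumes c: "c \<in> {1..Suc n}"
  shows "bij_betw (\<lambda>(m, R). ins c m R)
    ({1..Suc n} \<times> {R. R permutes {1..n}}) {R. R permutes {1..Suc n}}" (is "bij_betw ?f ?A ?B")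
proof -
  have inj: "inj_on ?f ?A"
  proof (clarsimp simp: inj_on_def)
    fix m m' R R' assume eq: "ins c m R = ins c m' R'"
    have at: "ins c m' R' m = c" by (simp flip: eq)
    have m: "m = m'"
    proof (cases m m' rule: skip_cases)
      case (2 i)
      then show ?thesis using at by (metis ins_skip skip_neq(1))
    qed
    have "R i = R' i" for i using fun_cong[OF eq, of "skip m i"] m by simp
    then show "m = m' \<and> R = R'" using m by auto
  qed
  have "?f ` ?A \<subseteq> ?B" using ins_permutes[OF _ c] by fastforce
  moreover have "card ?A = card ?B"
    by (simp add: card_cartesian_product card_permutations)
  ultimately have "card (?f ` ?A) = card ?B" and "?f ` ?A \<subseteq> ?B"
    using card_image[OF inj] by simp_all
  moreover have "finite ?B" by (simp add: finite_permutations)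
  ultimately have "?f ` ?A = ?B"
    using card_subset_eq by blast
  with inj show ?thesis by (simp only: bij_betw_def)
qed

section \<open>Relative ranks after an insertion\<close>

lemma rel_rank_ins_before:
  assumes "i < m"
  shows "rel_rank i (ins c m R) = rel_rank i R"
  using assms unfolding rel_rank_def
  by (intro arg_cong[where f = card]) (auto simp: ins_def)

text \<open>The first \<open>Suc i\<close> candidates are the shifted first \<open>i\<close> and the
  new one, which adds 1 exactly when it is better than the candidate being ranked.\<close>

lemma rel_rank_ins_after:
  assumes "1 \<le> m" "m \<le> i"
  shows "rel_rank (Suc i) (ins c m R) = rel_rank i R + (if c \<le> R i then 1 else 0)"
proof -
  have i: "Suc i = skip m i" using assms by (simp add: skip_def)
  let ?T = "{a. 1 \<le> a \<and> a \<le> i \<and> R a \<le> R i}"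
  have "{a. 1 \<le> a \<and> a \<le> skip m i \<and> ins c m R a \<le> ins c m R (skip m i)} =
      skip m ` ?T \<union> (if c \<le> R i then {m} else {})" (is "?L = ?M")
  proof (rule set_eqI)
    fix a
    show "a \<in> ?L \<longleftrightarrow> a \<in> ?M"
    proof (cases a m rule: skip_cases)
      case 1
      moreover have "c \<le> skip c (R i) \<longleftrightarrow> c \<le> R i" "m \<le> skip m i"
        using assms by (auto simp: skip_def)
      ultimately show ?thesis using assms by auto
    next
      case (2 b)
      moreover have "1 \<le> skip m b \<longleftrightarrow> 1 \<le> b" using assms by (auto simp: skip_def)
      ultimately show ?thesis by auto
    qed
  qed
  moreover have "card (skip m ` ?T) = card ?T"
    by (rule card_image) (simp add: inj_on_def)
  moreover have "m \<notin> skip m ` ?T" by auto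
  moreover have "finite ?T" by simp
  ultimately show ?thesis
    unfolding rel_rank_def i by simp
qed

lemma rel_rank_ins_at:
  assumes R: "R permutes {1..n}" and c: "c = 1 \<or> c = Suc n" and m: "m \<in> {1..Suc n}"
  shows "rel_rank m (ins c m R) = (if c = 1 then 1 else m)"
proof -
  have p: "ins c m R permutes {1..Suc n}"
    using ins_permutes[OF R _ m] c by auto
  have range: "ins c m R i \<in> {1..Suc n}" if "1 \<le> i" "i \<le> m" for i
    using permutes_in_image[OF p, of i] that m by auto
  have "{i. 1 \<le> i \<and> i \<le> m \<and> ins c m R i \<le> c} = (if c = 1 then {m} else {1..m})"
  proof (cases "c = 1")
    case True
    have "i = m" if "1 \<le> i" "i \<le> m" "ins c m R i \<le> c" for i
    proof -
      have "ins c m R i = ins c m R m" using that True range[of i] by simp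
      then show ?thesis using permutes_inj[OF p] by (simp only: inj_eq)
    qed
    moreover have "1 \<le> m" using m by simp
    ultimately show ?thesis using True by fastforce
  next
    case False
    then have "ins c m R i \<le> c" if "1 \<le> i" "i \<le> m" for i
      using range[OF that] c by simp
    with False show ?thesis by auto
  qed
  then show ?thesis by (simp add: rel_rank_def)
qed

text \<open>This is the online computability of the enlarged ranking: its first \<open>j\<close>
  relative ranks depend only on those of the real candidates seen so far.\<close>

lemma agree_ins:
  assumes R: "R permutes {1..n}" and Q: "Q permutes {1..n}"
    and c: "c = 1 \<or> c = Suc n" and m: "m \<in> {1..Suc n}" and j: "j \<le> Suc n"
    and RQ: "agree (min n (unskip m j)) R Q"
  shows "agree j (ins c m R) (ins c m Q)"
  unfolding agree_def
proof clarify
  fix i assume i: "1 \<le> i" "i \<le> j"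
  show "rel_rank i (ins c m R) = rel_rank i (ins c m Q)"
  proof (cases i m rule: linorder_cases)
    case less
    then have "i \<le> min n (unskip m j)" using i m j by (auto simp: unskip_def)
    then show ?thesis using less RQ i by (simp add: rel_rank_ins_before agree_def)
  next
    case equal
    then show ?thesis using rel_rank_ins_at R Q c m by simp
  next
    case greater
    define a where "a = i - 1"
    have a: "i = Suc a" "m \<le> a" "a \<in> {1..n}" using greater i m j by (auto simp: a_def)
    have "a \<le> min n (unskip m j)" using greater i j a by (auto simp: unskip_def)
    then have "rel_rank a R = rel_rank a Q" using RQ a by (simp add: agree_def)
    moreover have "R a \<in> {1..n}" "Q a \<in> {1..n}"
      using permutes_in_image[OF R] permutes_in_image[OF Q] a by blast+
    \<comment> \<open>Extremeness enters here: both sides are true for \<open>c = 1\<close> and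
      false for \<open>c = Suc n\<close>. For an intermediate \<open>c\<close> they could depend on
      unobserved absolute ranks.\<close>
    then have "c \<le> R a \<longleftrightarrow> c \<le> Q a" using c by auto
    ultimately show ?thesis using a m by (simp add: rel_rank_ins_after)
  qed
qed

text \<open>
  If \<open>\<tau>\<close> picks the fictitious candidate, then the simulated rule picks the real candidate at the
  same position; \<open>min n\<close> takes effect only if the fictitious candidate is picked in position
  \<open>n + 1\<close>.
\<close>

lemma simulated_stopping_rule:
  assumes \<tau>: "\<tau> \<in> stopping_rules (Suc n)" and n: "1 \<le> n"
    and c: "c = 1 \<or> c = Suc n" and m: "m \<in> {1..Suc n}"
  shows "(\<lambda>R. min n (unskip m (\<tau> (ins c m R)))) \<in> stopping_rules n"
proof -
  have p: "ins c m R permutes {1..Suc n}" if "R permutes {1..n}" for R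
    using ins_permutes[OF that _ m] c by auto
  have range: "\<tau> (ins c m R) \<in> {1..Suc n}" if "R permutes {1..n}" for R
    using p[OF that] \<tau> by (simp add: stopping_rules_iff)
  have "\<tau> (ins c m Q) = \<tau> (ins c m R)"
    if "R permutes {1..n}" "Q permutes {1..n}" "agree (min n (unskip m (\<tau> (ins c m R)))) R Q" for R Q
  proof -
    have "agree (\<tau> (ins c m R)) (ins c m R) (ins c m Q)"
      using agree_ins[OF that(1,2) c m _ that(3)] range[OF that(1)] by simp
    then show ?thesis using \<tau> p that by (simp add: stopping_rules_iff)
  qed
  moreover have "min n (unskip m (\<tau> (ins c m R))) \<in> {1..n}" if "R permutes {1..n}" for R
    using range[OF that] n m by (auto simp: unskip_def)
  ultimately show ?thesis
    unfolding stopping_rules_iff by (metis (no_types, lifting))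
qed

section \<open>Success probability of the simulated rules\<close>

lemma simulated_success:
  assumes R: "R permutes {1..n}" and k: "k \<in> {1..n}" and success: "ins c m R j = skip c k"
  shows "R (min n (unskip m j)) = k"
proof (cases j m rule: skip_cases)
  case 1
  \<comment> \<open>Impossible case: position \<open>m\<close> has rank \<open>c\<close>, a value
    that \<open>skip c\<close> omits.\<close>
  then show ?thesis using success by simp
next
  case (2 i)
  then have "R i = k" using success by simp
  \<comment> \<open>This makes the cap at \<open>n\<close> inactive.\<close>
  moreover have "i \<in> {1..n}" using permutes_in_image[OF R, of i] \<open>R i = k\<close> k by simp
  ultimately show ?thesis using 2 by simp
qed

text \<open>Both inequalities at once: \<open>skip c k\<close> is \<open>k\<close> for
  \<open>c = Suc n\<close> and \<open>Suc k\<close> for \<open>c = 1\<close>.\<close>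

lemma p_best_skip_le:
  assumes k: "k \<in> {1..n}" and c: "c = 1 \<or> c = Suc n"
  shows "p_best (skip c k) (Suc n) \<le> p_best k n"
  unfolding p_best_def[of "skip c k"]
proof (rule cSUP_least)
  show "stopping_rules (Suc n) \<noteq> {}"
    using const_stopping_rule[of "Suc n"] by auto
next
  fix \<tau> assume \<tau>: "\<tau> \<in> stopping_rules (Suc n)"
  define \<sigma> where "\<sigma> m R = min n (unskip m (\<tau> (ins c m R)))" for m R
  let ?W = "{R. R permutes {1..Suc n} \<and> R (\<tau> R) = skip c k}"
  let ?V = "\<lambda>m. {R. R permutes {1..n} \<and> R (\<sigma> m R) = k}"
  \<comment> \<open>Every ranking on which \<open>\<tau>\<close> wins arises by inserting at some
    \<open>m\<close> into a ranking on which \<open>\<sigma> m\<close> wins. An inclusion suffices,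
    since only an upper bound on \<open>card ?W\<close> is sought.\<close>
  have "?W \<subseteq> (\<lambda>(m, R). ins c m R) ` (SIGMA m:{1..Suc n}. ?V m)"
  proof
    fix S assume S: "S \<in> ?W"
    moreover have "c \<in> {1..Suc n}" using c by auto
    ultimately have "S \<in> (\<lambda>(m, R). ins c m R) ` ({1..Suc n} \<times> {R. R permutes {1..n}})"
      using bij_betw_imp_surj_on[OF bij_betw_ins] by blast
    then obtain m R where mR: "m \<in> {1..Suc n}" "R permutes {1..n}" "S = ins c m R"
      by (elim imageE SigmaE) simp
    have "R (\<sigma> m R) = k"
      unfolding \<sigma>_def by (rule simulated_success[OF mR(2) k]) (use S mR(3) in blast)
    with mR show "S \<in> (\<lambda>(m, R). ins c m R) ` (SIGMA m:{1..Suc n}. ?V m)"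
      by (intro image_eqI[of _ _ "(m, R)"]) simp_all
  qed
  moreover have fin: "finite (?V m)" for m
    by (simp add: finite_permutations)
  then have "finite (SIGMA m:{1..Suc n}. ?V m)"
    by (intro finite_SigmaI) simp_all
  ultimately have "card ?W \<le> card (SIGMA m:{1..Suc n}. ?V m)"
    using surj_card_le by blast
  also have "\<dots> = (\<Sum>m\<in>{1..Suc n}. card (?V m))"
    using fin by (intro card_SigmaI) simp_all
  finally have "real (card ?W) \<le> real (\<Sum>m\<in>{1..Suc n}. card (?V m))"
    by (simp only: of_nat_le_iff)
  also have "\<dots> = (\<Sum>m\<in>{1..Suc n}. real (card (?V m)))"
    by (rule of_nat_sum)
  also have "\<dots> \<le> (\<Sum>m\<in>{1..Suc n}. fact n * p_best k n)"
  proof (rule sum_mono)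
    fix m assume m: "m \<in> {1..Suc n}"
    have "1 \<le> n" using k by simp
    then have "\<P>(R in rank_space n. R (\<sigma> m R) = k) \<le> p_best k n"
      unfolding \<sigma>_def by (intro prob_le_p_best simulated_stopping_rule[OF \<tau> _ c m])
    then show "real (card (?V m)) \<le> fact n * p_best k n"
      by (simp add: prob_rank_space field_simps)
  qed
  also have "\<dots> = fact (Suc n) * p_best k n"
    by (simp add: algebra_simps)
  finally show "\<P>(R in rank_space (Suc n). R (\<tau> R) = skip c k) \<le> p_best k n"
    by (simp only: prob_rank_space) (simp add: divide_le_eq mult.commute del: fact_Suc)
qed

section \<open>Monotonicity and limits\<close>

lemma p_best_Suc_le:
  "1 \<le> k \<Longrightarrow> k \<le> n \<Longrightarrow> p_best k (Suc n) \<le> p_best k n"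
  using p_best_skip_le[of k n "Suc n"] by (simp add: skip_def)

lemma p_best_Suc_Suc_le:
  "1 \<le> k \<Longrightarrow> k \<le> n \<Longrightarrow> p_best (Suc k) (Suc n) \<le> p_best k n"
  using p_best_skip_le[of k n 1] by (simp add: skip_def)

lemma convergent_p_best:
  assumes "1 \<le> k"
  shows "convergent (p_best k)"
proof -
  \<comment> \<open>The shift by \<open>k\<close> restricts to sizes at least \<open>k\<close>,
    where monotonicity is available; 0 is a lower bound.\<close>
  have dec: "decseq (\<lambda>n. p_best k (n + k))"
    using assms by (intro decseq_SucI) (simp add: p_best_Suc_le)
  have "convergent (\<lambda>n. p_best k (n + k))"
    using decseq_convergent[OF dec, of 0] p_best_nonneg assms
    by (metis convergent_def le_add2 order_trans)
  then show ?thesis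
    by (simp add: convergent_ignore_initial_segment)
qed

lemma p_inf_Suc_le:
  assumes "1 \<le> k"
  shows "p_inf (Suc k) \<le> p_inf k"
proof (rule LIMSEQ_le)
  show "p_best k \<longlonglongrightarrow> p_inf k"
    using convergent_p_best[OF assms] by (simp add: p_inf_def convergent_LIMSEQ_iff)
  have "p_best (Suc k) \<longlonglongrightarrow> p_inf (Suc k)"
    using convergent_p_best[of "Suc k"] by (simp add: p_inf_def convergent_LIMSEQ_iff)
  \<comment> \<open>Shifting the size by one keeps the limit and aligns the sequence with the
    diagonal inequality.\<close>
  then show "(\<lambda>n. p_best (Suc k) (Suc n)) \<longlonglongrightarrow> p_inf (Suc k)"
    by (rule LIMSEQ_Suc)
  show "\<exists>N. \<forall>n\<ge>N. p_best (Suc k) (Suc n) \<le> p_best k n"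
    using p_best_Suc_Suc_le[OF assms] by blast
qed

theorem theorem3p2:
  shows "(\<forall>k n. 1 \<le> k \<and> k \<le> n \<longrightarrow> p_best k n \<ge> p_best k (n + 1) \<and> p_best k n \<ge> p_best (k + 1) (n + 1)) \<and>
    (\<forall>k\<ge>1. convergent (\<lambda>n. p_best k n) \<and> p_inf k \<ge> p_inf (k + 1))"
  using p_best_Suc_le p_best_Suc_Suc_le convergent_p_best p_inf_Suc_le by simp

end
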